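(* Let $k\ge 1$, and let $\mathcal{T}^{k,2}$ denote the set of all stable labeled configurations reachable from $\Delta^{k,2}$. The configurations in $\mathcal{T}^{k,2}$ are in bijection with the standard Young tableaux of shape $(2)^k=(2,\dots,2)\in\mathbb{Z}^k$ ($k$ rows of length $2$) filled with the integers in $[2k]$, and are thus counted by the Catalan number $\frac{1}{k+1}\binom{2k}{k}$. The bijection $\varphi$ sends $\mathcal{C}\in\mathcal{T}^{k,2}$ to the tableau whose entry in row $i$ and column $j$ is the label of the chip in $\mathcal{C}(v_{i,j})$, for $(i,j)\in[k]\times[2]$. Its inverse sends a standard Young tableau $Y=(y_{i,j})$ to the configuration $\mathcal{C}$ with $\mathcal{C}(v_{i,j})=\{y_{i,j}\}$ for $(i,j)\in[k]\times[2]$ and $\mathcal{C}(v)=\emptyset$ for all other vertices $v$.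
   Context: Notation: $[n]=\{1,\dots,n\}$. The infinite $k$-star graph $\operatorname{instar}(k)$ is the undirected graph with a center vertex, denoted $v_{i,0}$ for every $i\in[k]$ (all these symbols denote the same vertex), and $k$ branches; branch $i$ is the infinite path $v_{i,0},v_{i,1},v_{i,2},\dots$, with $v_{i,j}$ adjacent to $v_{i,j+1}$ for all $j\ge 0$. So the center has degree $k$ and every other vertex has degree $2$. Labeled chip-firing: there are $N=km$ chips labeled bijectively by $[N]$. A labeled configuration $\mathcal{C}$ assigns to each vertex $v$ the set $\mathcal{C}(v)$ of chips on it. A vertex $v$ is ready to fire if $|\mathcal{C}(v)|\ge\deg(v)$. To fire it, one chooses any $\deg(v)$ of its chips and moves them as follows. When firing the center, if the chosen chips have labels $n_1<\cdots<n_k$, then chip $n_i$ is sent to $v_{i,1}$ for each $i\in[k]$. When firing $v_{i,j}$ with $j\ne 0$, if the two chosen chips have labels $a<b$, then $a$ is sent to $v_{i,j-1}$ and $b$ to $v_{i,j+1}$. Vertices are fired one at a time. A configuration is stable if no vertex is ready to fire, and it is reachable from another configuration if it is obtained by a finite sequence of legal fires. $\Delta^{k,m}$ is the labeled configuration with all $km$ chips on the center; here $m=2$. It is known that in every stable configuration reachable from $\Delta^{k,m}$ there is exactly one chip on each $v_{i,j}$ with $(i,j)\in[k]\times[m]$ and no chips elsewhere. A standard Young tableau of shape $(2)^k$ is a filling of the $k\times 2$ array with the numbers in $[2k]$, each used exactly once, with entries strictly increasing along each row from left to right and down each column from top to bottom. *)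

theory Defs
  imports Complex_Main "HOL-Library.FuncSet"
begin

text \<open>
  Vertices of the infinite \<open>k\<close>-star graph. \<open>Branch i j\<close> is only a vertex of the graph for
  \<open>1 \<le> i \<le> k\<close> and \<open>j \<ge> 1\<close>; all the symbols \<open>v\<^sub>i\<^sub>,\<^sub>0\<close> denote \<open>Center\<close>, so vertices are
  referred to through \<open>vtx\<close>.
\<close>

datatype vertex = Center | Branch nat nat

definition vtx :: "nat \<Rightarrow> nat \<Rightarrow> vertex" where
  "vtx i j = (if j = 0 then Center else Branch i j)"

definition instar_verts :: "nat \<Rightarrow> vertex set" where
  "instar_verts k = {vtx i j | i j. i \<in> {1..k}}"

definition instar_edges :: "nat \<Rightarrow> vertex set set" where
  "instar_edges k = {{vtx i j, vtx i (Suc j)} | i j. i \<in> {1..k}}"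

definition deg :: "nat \<Rightarrow> vertex \<Rightarrow> nat" where
  "deg k x = card {y. {x, y} \<in> instar_edges k}"

lemma deg_Center: "deg k Center = k"
proof -
  have "{y. {Center, y} \<in> instar_edges k} = (\<lambda>i. Branch i 1) ` {1..k}"
    by (fastforce simp: instar_edges_def vtx_def doubleton_eq_iff split: if_splits)
  moreover have "inj_on (\<lambda>i. Branch i 1) {1..k}"
    by (auto simp: inj_on_def)
  ultimately show ?thesis
    by (simp add: deg_def card_image)
qed

lemma deg_vtx:
  assumes "i \<in> {1..k}" "j \<noteq> 0"
  shows "deg k (vtx i j) = 2"
proof -
  have "y \<in> {vtx i (j - 1), vtx i (j + 1)}" if "{vtx i j, y} \<in> instar_edges k" for y
    using that assms
    by (auto simp: instar_edges_def vtx_def doubleton_eq_iff split: if_splits)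
  moreover have "{vtx i j, vtx i (j - 1)} \<in> instar_edges k"
  proof -
    have "{vtx i j, vtx i (j - 1)} = {vtx i (j - 1), vtx i (Suc (j - 1))}"
      using assms by auto
    then show ?thesis
      unfolding instar_edges_def using assms by blast
  qed
  moreover have "{vtx i j, vtx i (j + 1)} \<in> instar_edges k"
    using assms by (auto simp: instar_edges_def)
  ultimately have "{y. {vtx i j, y} \<in> instar_edges k} = {vtx i (j - 1), vtx i (j + 1)}"
    by blast
  moreover have "vtx i (j - 1) \<noteq> vtx i (j + 1)"
    by (auto simp: vtx_def)
  ultimately show ?thesis
    by (simp add: deg_def)
qed

text \<open>
  A labeled configuration maps every vertex to the set of (labels of) chips on it. Arguments that
  are not vertices of the graph hold no chips in the initial configuration and never receive any.
\<close>

type_synonym config = "vertex \<Rightarrow> nat set"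

definition ready :: "nat \<Rightarrow> config \<Rightarrow> vertex \<Rightarrow> bool" where
  "ready k C x \<longleftrightarrow> card (C x) \<ge> deg k x"

text \<open>
  One legal fire. The chosen chips are \<open>n 1 < \<dots> < n k\<close> at the center (cf. \<open>deg_Center\<close>) and
  \<open>a < b\<close> at the other vertices (cf. \<open>deg_vtx\<close>).
\<close>

inductive fires :: "nat \<Rightarrow> config \<Rightarrow> config \<Rightarrow> bool" for k where
  center: "\<lbrakk>ready k C Center; strict_mono_on {1..k} n; n ` {1..k} \<subseteq> C Center\<rbrakk> \<Longrightarrow>
    fires k C (\<lambda>x. case x of
        Center \<Rightarrow> C Center - n ` {1..k}
      | Branch i j \<Rightarrow> if i \<in> {1..k} \<and> j = 1 then insert (n i) (C x) else C x)"
| branch: "\<lbrakk>i \<in> {1..k}; j \<noteq> 0; ready k C (vtx i j); a \<in> C (vtx i j); b \<in> C (vtx i j); a < b\<rbrakk> \<Longrightarrow>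
    fires k C (C(vtx i j := C (vtx i j) - {a, b},
                 vtx i (j - 1) := insert a (C (vtx i (j - 1))),
                 vtx i (j + 1) := insert b (C (vtx i (j + 1)))))"

definition stable :: "nat \<Rightarrow> config \<Rightarrow> bool" where
  "stable k C \<longleftrightarrow> (\<forall>x\<in>instar_verts k. \<not> ready k C x)"

definition reachable :: "nat \<Rightarrow> config \<Rightarrow> config \<Rightarrow> bool" where
  "reachable k = (fires k)\<^sup>*\<^sup>*"

definition Delta :: "nat \<Rightarrow> nat \<Rightarrow> config" where
  "Delta k m = (\<lambda>x. {})(Center := {1..k * m})"

definition stable_configs :: "nat \<Rightarrow> nat \<Rightarrow> config set" where
  "stable_configs k m = {C. reachable k (Delta k m) C \<and> stable k C}"

text \<open>
  Standard Young tableaux of rectangular shape \<open>(m)\<^sup>k\<close>: \<open>k\<close> rows of length \<open>m\<close>. The value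
  \<open>Y (i, j)\<close> is the entry in row \<open>i\<close> and column \<open>j\<close>; extensionality makes a tableau determined by
  its entries.
\<close>

definition rect_SYT :: "nat \<Rightarrow> nat \<Rightarrow> (nat \<times> nat \<Rightarrow> nat) set" where
  "rect_SYT k m = {Y \<in> extensional ({1..k} \<times> {1..m}).
     bij_betw Y ({1..k} \<times> {1..m}) {1..k * m} \<and>
     (\<forall>i\<in>{1..k}. strict_mono_on {1..m} (\<lambda>j. Y (i, j))) \<and>
     (\<forall>j\<in>{1..m}. strict_mono_on {1..k} (\<lambda>i. Y (i, j)))}"

definition tableau_of :: "nat \<Rightarrow> nat \<Rightarrow> config \<Rightarrow> (nat \<times> nat \<Rightarrow> nat)" where
  "tableau_of k m C = (\<lambda>(i, j)\<in>{1..k} \<times> {1..m}. the_elem (C (vtx i j)))"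

definition config_of :: "nat \<Rightarrow> nat \<Rightarrow> (nat \<times> nat \<Rightarrow> nat) \<Rightarrow> config" where
  "config_of k m Y = (\<lambda>x. case x of
       Center \<Rightarrow> {}
     | Branch i j \<Rightarrow> if (i, j) \<in> {1..k} \<times> {1..m} then {Y (i, j)} else {})"

end

theory Submission
  imports Defs
begin

text \<open>
  With two columns the chips have almost no freedom. At first only the center can fire, and after
  one firing it is again the only vertex that can; its second firing must use all \<open>k\<close> chips that are
  left. Now branch \<open>i\<close> holds two chips \<open>n i\<close> and \<open>n' i\<close> at distance one, where \<open>n\<close> and \<open>n'\<close> are
  increasing enumerations of two complementary halves of \<open>{1..2k}\<close>. Each of these vertices must
  fire exactly once, in any order: \<open>min (n i) (n' i)\<close> returns to the center and
  \<open>max (n i) (n' i)\<close> moves outwards. When all have fired, the center has \<open>k\<close> chips again, namely the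
  minima, and a last firing sends the \<open>i\<close>-th smallest minimum to branch \<open>i\<close>. Minima and maxima of
  two increasing sequences increase, so this \<open>i\<close>-th smallest minimum is the chip that came from
  branch \<open>i\<close>, and the array of minima and maxima is a standard Young tableau
  (\<open>sorted_rows_SYT\<close>). Hence every run ends in the configuration of a tableau. Conversely, a
  tableau \<open>Y\<close> is reached by choosing its two columns as \<open>n\<close> and \<open>n'\<close> (\<open>reachable_config_of\<close>). Thus
  \<open>stable_configs k 2\<close> is exactly the image of \<open>rect_SYT k 2\<close> under \<open>config_of\<close>
  (\<open>stable_configs_eq\<close>).

  For the Catalan number, tableaux whose two columns have lengths \<open>b \<le> a\<close> are counted by removing
  the largest entry, which sits at the bottom of one of the columns. This gives the recursion of
  the ballot numbers, solved by \<open>(a + b choose a) - (a + b choose Suc a)\<close>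
  (\<open>card_two_column_SYT\<close>).
\<close>

section \<open>Strictly increasing enumerations\<close>

text \<open>
  An increasing enumeration is determined by its image: the \<open>i\<close>-th value is the element with
  exactly \<open>i - 1\<close> elements of the image below it.
\<close>

lemma strict_mono_on_same_image_unique:
  fixes f g :: "nat \<Rightarrow> nat"
  assumes f: "strict_mono_on {1..k} f" and g: "strict_mono_on {1..k} g"
    and img: "f ` {1..k} = g ` {1..k}" and i: "i \<in> {1..k}"
  shows "f i = g i"
proof -
  let ?below = "\<lambda>y. {z \<in> f ` {1..k}. z < y}"
  have rank: "card (?below (h i)) = i - 1"
    if h: "strict_mono_on {1..k} h" and him: "h ` {1..k} = f ` {1..k}" for h :: "nat \<Rightarrow> nat"
  proof -
    have "?below (h i) = h ` {1..<i}"
    proof -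
      have "?below (h i) = h ` {j \<in> {1..k}. h j < h i}"
        unfolding him[symmetric] by auto
      also have "{j \<in> {1..k}. h j < h i} = {1..<i}"
        using strict_mono_on_less[OF h] i by auto
      finally show ?thesis .
    qed
    moreover have "inj_on h {1..<i}"
      using strict_mono_on_imp_inj_on[OF h] by (rule inj_on_subset) (use i in auto)
    ultimately show ?thesis
      by (simp add: card_image)
  qed
  have no_gap: "\<not> x < y" if "x \<in> f ` {1..k}" "card (?below x) = card (?below y)" for x y
  proof
    assume "x < y"
    then have "?below x \<subset> ?below y"
      using that(1) by auto
    then have "card (?below x) < card (?below y)"
      by (intro psubset_card_mono) auto
    then show False
      using that(2) by simp
  qed
  have "f i \<in> f ` {1..k}" "g i \<in> f ` {1..k}"
    using i img by auto
  moreover have "card (?below (f i)) = card (?below (g i))"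
    using rank[OF f] rank[OF g] img by simp
  ultimately show ?thesis
    by (metis no_gap nat_neq_iff)
qed

section \<open>The stages of a run\<close>

lemma rect_SYT_2_iff:
  "Y \<in> rect_SYT k 2 \<longleftrightarrow>
    Y \<in> extensional ({1..k} \<times> {1..2}) \<and> bij_betw Y ({1..k} \<times> {1..2}) {1..k * 2} \<and>
    (\<forall>i\<in>{1..k}. Y (i, 1) < Y (i, 2)) \<and>
    strict_mono_on {1..k} (\<lambda>i. Y (i, 1)) \<and> strict_mono_on {1..k} (\<lambda>i. Y (i, 2))"
proof -
  have two: "{1..2} = {1, 2::nat}"
    by auto
  have row: "strict_mono_on {1, 2::nat} h \<longleftrightarrow> h 1 < h 2" for h :: "nat \<Rightarrow> nat"
    by (auto simp: strict_mono_on_def)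
  show ?thesis
    unfolding rect_SYT_def two row by auto
qed

text \<open>
  The configuration after the first firing of the center, with chips \<open>n 1 < \<dots> < n k\<close>.
\<close>

definition first_wave :: "nat \<Rightarrow> (nat \<Rightarrow> nat) \<Rightarrow> config" where
  "first_wave k n = (\<lambda>x. case x of
       Center \<Rightarrow> {1..k * 2} - n ` {1..k}
     | Branch i j \<Rightarrow> if i \<in> {1..k} \<and> j = 1 then {n i} else {})"

text \<open>
  The configurations between the second and the third firing of the center, in terms of the
  tableau \<open>Y\<close> that the run will end in; \<open>F\<close> is the set of branches whose first vertex has fired.
\<close>

definition second_wave :: "nat \<Rightarrow> (nat \<times> nat \<Rightarrow> nat) \<Rightarrow> nat set \<Rightarrow> config" where
  "second_wave k Y F = (\<lambda>x. case x of
       Center \<Rightarrow> (\<lambda>i. Y (i, 1)) ` F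
     | Branch i j \<Rightarrow>
         if i \<notin> {1..k} then {}
         else if i \<in> F then (if j = 2 then {Y (i, 2)} else {})
         else (if j = 1 then {Y (i, 1), Y (i, 2)} else {}))"

definition sorted_rows :: "nat \<Rightarrow> (nat \<Rightarrow> nat) \<Rightarrow> (nat \<Rightarrow> nat) \<Rightarrow> (nat \<times> nat \<Rightarrow> nat)" where
  "sorted_rows k n n' = (\<lambda>(i, j)\<in>{1..k} \<times> {1..2}.
     if j = 1 then min (n i) (n' i) else max (n i) (n' i))"

text \<open>
  Columns increase because minima and maxima of increasing sequences increase. The entries are
  distinct because they fill \<open>2k\<close> cells with \<open>2k\<close> different values, and this makes the rows strict.
\<close>

lemma sorted_rows_SYT:
  assumes n: "strict_mono_on {1..k} n" and n': "strict_mono_on {1..k} n'"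
    and part: "n ` {1..k} \<union> n' ` {1..k} = {1..k * 2}"
  shows "sorted_rows k n n' \<in> rect_SYT k 2"
proof -
  let ?Y = "sorted_rows k n n'" and ?cells = "{1..k} \<times> {1..2::nat}"
  have entries: "?Y (i, 1) = min (n i) (n' i)" "?Y (i, 2) = max (n i) (n' i)"
    if "i \<in> {1..k}" for i
    using that by (auto simp: sorted_rows_def)
  have "{1..2} = {1, 2::nat}"
    by auto
  then have "?cells = (\<lambda>i. (i, 1)) ` {1..k} \<union> (\<lambda>i. (i, 2)) ` {1..k}"
    by auto
  then have "?Y ` ?cells = (\<lambda>i. ?Y (i, 1)) ` {1..k} \<union> (\<lambda>i. ?Y (i, 2)) ` {1..k}"
    by (simp only: image_Un image_image)
  also have "\<dots> = (\<Union>i\<in>{1..k}. {?Y (i, 1), ?Y (i, 2)})"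
    by auto
  also have "\<dots> = (\<Union>i\<in>{1..k}. {n i, n' i})"
    by (intro SUP_cong refl) (auto simp: entries min_def max_def simp del: One_nat_def)
  also have "\<dots> = {1..k * 2}"
    unfolding part[symmetric] by auto
  finally have img: "?Y ` ?cells = {1..k * 2}" .
  have "inj_on ?Y ?cells"
    by (rule eq_card_imp_inj_on) (simp_all add: img card_cartesian_product del: One_nat_def)
  then have bij: "bij_betw ?Y ?cells {1..k * 2}"
    using img by (simp add: bij_betw_def)
  have ne: "n i \<noteq> n' i" if i: "i \<in> {1..k}" for i
  proof
    assume "n i = n' i"
    then have "?Y (i, 1) = ?Y (i, 2)"
      using entries[OF i] by simp
    then have "(i, 1::nat) = (i, 2)"
      using bij i by (intro inj_onD[of ?Y ?cells]) (auto simp: bij_betw_def)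
    then show False
      by simp
  qed
  have ext: "?Y \<in> extensional ?cells"
    by (simp add: sorted_rows_def)
  show ?thesis
    unfolding rect_SYT_2_iff
  proof (intro conjI ballI ext bij)
    show "?Y (i, 1) < ?Y (i, 2)" if "i \<in> {1..k}" for i
      using entries[OF that] ne[OF that] by simp
    have mono: "n r < n s" "n' r < n' s" if "r \<in> {1..k}" "s \<in> {1..k}" "r < s" for r s
      using strict_mono_onD[OF n that] strict_mono_onD[OF n' that] by simp_all
    show "strict_mono_on {1..k} (\<lambda>i. ?Y (i, 1))"
    proof (rule strict_mono_onI)
      fix r s assume rs: "r \<in> {1..k}" "s \<in> {1..k}" "r < s"
      show "?Y (r, 1) < ?Y (s, 1)"
        unfolding entries[OF rs(1)] entries[OF rs(2)] using mono[OF rs] by linarith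
    qed
    show "strict_mono_on {1..k} (\<lambda>i. ?Y (i, 2))"
    proof (rule strict_mono_onI)
      fix r s assume rs: "r \<in> {1..k}" "s \<in> {1..k}" "r < s"
      show "?Y (r, 2) < ?Y (s, 2)"
        unfolding entries[OF rs(1)] entries[OF rs(2)] using mono[OF rs] by linarith
    qed
  qed
qed

text \<open>
  The results of a single fire, named so that each stage of the run can be computed on its own.
\<close>

definition center_fire :: "nat \<Rightarrow> config \<Rightarrow> (nat \<Rightarrow> nat) \<Rightarrow> config" where
  "center_fire k C n = (\<lambda>x. case x of
        Center \<Rightarrow> C Center - n ` {1..k}
      | Branch i j \<Rightarrow> if i \<in> {1..k} \<and> j = 1 then insert (n i) (C x) else C x)"

definition branch_fire :: "config \<Rightarrow> nat \<Rightarrow> nat \<Rightarrow> nat \<Rightarrow> nat \<Rightarrow> config" where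
  "branch_fire C i j a b = C(vtx i j := C (vtx i j) - {a, b},
                 vtx i (j - 1) := insert a (C (vtx i (j - 1))),
                 vtx i (j + 1) := insert b (C (vtx i (j + 1))))"

lemma center_fire_Delta: "center_fire k (Delta k 2) n = first_wave k n"
  by (auto simp: center_fire_def Delta_def first_wave_def fun_eq_iff split: vertex.splits)

lemma center_fire_first_wave:
  assumes "n' ` {1..k} = {1..k * 2} - n ` {1..k}"
  shows "center_fire k (first_wave k n) n' = second_wave k (sorted_rows k n n') {}"
proof
  fix x
  show "center_fire k (first_wave k n) n' x = second_wave k (sorted_rows k n n') {} x"
  proof (cases x)
    case Center
    then show ?thesis
      by (simp add: center_fire_def first_wave_def second_wave_def assms del: One_nat_def)
  next
    case (Branch i j)
    have "{n' i, n i} = {min (n i) (n' i), max (n i) (n' i)}"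
      by (auto simp: min_def max_def)
    then show ?thesis
      by (simp add: Branch center_fire_def first_wave_def second_wave_def sorted_rows_def)
  qed
qed

lemma branch_fire_second_wave:
  assumes "i \<in> {1..k}" "i \<notin> F"
  shows "branch_fire (second_wave k Y F) i 1 (Y (i, 1)) (Y (i, 2)) = second_wave k Y (insert i F)"
proof
  fix x
  show "branch_fire (second_wave k Y F) i 1 (Y (i, 1)) (Y (i, 2)) x =
      second_wave k Y (insert i F) x"
    using assms by (cases x) (auto simp: branch_fire_def second_wave_def vtx_def simp del: One_nat_def)
qed

lemma center_fire_second_wave:
  assumes "\<And>i. i \<in> {1..k} \<Longrightarrow> n i = Y (i, 1)"
  shows "center_fire k (second_wave k Y {1..k}) n = config_of k 2 Y"
proof -
  have "(\<lambda>i. Y (i, 1)) ` {1..k} = n ` {1..k}"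
    using assms by (intro image_cong) auto
  then show ?thesis
    using assms
    by (auto simp: center_fire_def second_wave_def config_of_def fun_eq_iff split: vertex.splits)
qed

lemma card_center_first_wave:
  assumes "strict_mono_on {1..k} n" "n ` {1..k} \<subseteq> {1..k * 2}"
  shows "card (first_wave k n Center) = k"
  using assms strict_mono_on_imp_inj_on[OF assms(1)]
  by (simp add: first_wave_def card_Diff_subset card_image)

lemma card_center_second_wave:
  assumes "Y \<in> rect_SYT k 2" "F \<subseteq> {1..k}"
  shows "card (second_wave k Y F Center) = card F"
proof -
  have "inj_on (\<lambda>i. Y (i, 1)) {1..k}"
    using assms by (intro strict_mono_on_imp_inj_on) (simp add: rect_SYT_2_iff)
  then show ?thesis
    using assms(2) by (simp add: second_wave_def card_image inj_on_subset)
qed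

text \<open>
  The invariant of a run: everything reachable from \<open>Delta k 2\<close> is of one of these four kinds.
\<close>

inductive wave_stage :: "nat \<Rightarrow> config \<Rightarrow> bool" for k where
  initial: "wave_stage k (Delta k 2)"
| first: "\<lbrakk>strict_mono_on {1..k} n; n ` {1..k} \<subseteq> {1..k * 2}\<rbrakk> \<Longrightarrow>
    wave_stage k (first_wave k n)"
| second: "\<lbrakk>Y \<in> rect_SYT k 2; F \<subseteq> {1..k}\<rbrakk> \<Longrightarrow> wave_stage k (second_wave k Y F)"
| final: "Y \<in> rect_SYT k 2 \<Longrightarrow> wave_stage k (config_of k 2 Y)"

text \<open>
  Counting chips leaves no choice after the first firing: the second one takes all \<open>k\<close> chips
  left at the center, and the third one requires all \<open>k\<close> branches to have returned their
  smaller chip, so it deals out the first column of the tableau in order.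
\<close>

lemma wave_stage_center_fire:
  assumes k: "k \<ge> 1" and C: "wave_stage k C" and rdy: "ready k C Center"
    and n': "strict_mono_on {1..k} n'" "n' ` {1..k} \<subseteq> C Center"
  shows "wave_stage k (center_fire k C n')"
  using C
proof cases
  case initial
  then have "n' ` {1..k} \<subseteq> {1..k * 2}"
    using n'(2) by (simp add: Delta_def)
  then show ?thesis
    unfolding initial center_fire_Delta using n'(1) by (rule wave_stage.first[rotated])
next
  case (first n)
  have "card (n' ` {1..k}) = k"
    using strict_mono_on_imp_inj_on[OF n'(1)] by (simp add: card_image)
  moreover have "card (first_wave k n Center) = k"
    using first by (intro card_center_first_wave)
  moreover have "finite (first_wave k n Center)"
    by (simp add: first_wave_def)
  ultimately have "n' ` {1..k} = first_wave k n Center"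
    using n'(2) first(1) by (intro card_subset_eq) auto
  then have rest: "n' ` {1..k} = {1..k * 2} - n ` {1..k}"
    by (simp add: first_wave_def)
  then have "n ` {1..k} \<union> n' ` {1..k} = {1..k * 2}"
    using first(3) by auto
  then have "sorted_rows k n n' \<in> rect_SYT k 2"
    using first(2) n'(1) by (intro sorted_rows_SYT)
  then show ?thesis
    unfolding first(1) center_fire_first_wave[OF rest] by (rule wave_stage.second) simp
next
  case (second Y F)
  have fin: "finite F"
    using second(3) finite_subset by blast
  have "card F \<ge> k"
    using rdy second card_center_second_wave[of Y k F] by (simp add: ready_def deg_Center)
  then have F: "F = {1..k}"
    using second(3) by (intro card_seteq) auto
  have "n' ` {1..k} \<subseteq> (\<lambda>i. Y (i, 1)) ` {1..k}"
    using n'(2) second(1) F by (simp add: second_wave_def)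
  moreover have col: "strict_mono_on {1..k} (\<lambda>i. Y (i, 1))"
    using second(2) by (simp add: rect_SYT_2_iff)
  ultimately have "n' ` {1..k} = (\<lambda>i. Y (i, 1)) ` {1..k}"
    using strict_mono_on_imp_inj_on[OF n'(1)] strict_mono_on_imp_inj_on[OF col]
    by (intro card_subset_eq) (auto simp: card_image)
  then have "n' i = Y (i, 1)" if "i \<in> {1..k}" for i
    using strict_mono_on_same_image_unique[OF n'(1) col _ that] by simp
  then show ?thesis
    unfolding second(1) F using second(2)
    by (subst center_fire_second_wave) (auto intro: wave_stage.final)
next
  case (final Y)
  then show ?thesis
    using k rdy by (simp add: ready_def deg_Center config_of_def)
qed

lemma wave_stage_branch_fire:
  assumes C: "wave_stage k C" and i: "i \<in> {1..k}" and j: "j \<noteq> 0"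
    and ab: "a \<in> C (vtx i j)" "b \<in> C (vtx i j)" "a < b"
  shows "wave_stage k (branch_fire C i j a b)"
  using C
proof cases
  case initial
  then show ?thesis
    using ab j by (simp add: Delta_def vtx_def)
next
  case (first n)
  then show ?thesis
    using ab j by (simp add: first_wave_def vtx_def split: if_splits)
next
  case (second Y F)
  then have iF: "i \<notin> F" and j1: "j = 1"
    and chips: "a \<in> {Y (i, 1), Y (i, 2)}" "b \<in> {Y (i, 1), Y (i, 2)}"
    using ab j i by (auto simp: second_wave_def vtx_def split: if_splits)
  have "Y (i, 1) < Y (i, 2)"
    using second(2) i by (simp add: rect_SYT_2_iff)
  then have "a = Y (i, 1)" "b = Y (i, 2)"
    using chips ab(3) by auto
  then have "branch_fire C i j a b = second_wave k Y (insert i F)"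
    using branch_fire_second_wave[OF i iF] second(1) j1 by simp
  moreover have "insert i F \<subseteq> {1..k}"
    using second(3) i by simp
  ultimately show ?thesis
    using wave_stage.second[OF second(2)] by simp
next
  case (final Y)
  then show ?thesis
    using ab j by (simp add: config_of_def vtx_def split: if_splits)
qed

lemma reachable_wave_stage:
  assumes "k \<ge> 1" "reachable k (Delta k 2) C"
  shows "wave_stage k C"
  using assms(2) unfolding reachable_def
proof (induction rule: rtranclp_induct)
  case base
  show ?case
    by (rule wave_stage.initial)
next
  case (step C C')
  from step.hyps(2) show ?case
  proof cases
    case (center n)
    then show ?thesis
      using wave_stage_center_fire[OF assms(1) step.IH, of n] by (simp add: center_fire_def)
  next
    case (branch i j a b)
    show ?thesis
      using wave_stage_branch_fire[OF step.IH branch(2,3,5,6,7)]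
      unfolding branch_fire_def branch(1) .
  qed
qed

lemma stable_wave_stage:
  assumes k: "k \<ge> 1" and C: "wave_stage k C" and st: "stable k C"
  shows "C \<in> config_of k 2 ` rect_SYT k 2"
proof -
  have "vtx 1 0 \<in> instar_verts k"
    using k unfolding instar_verts_def by force
  then have center: "card (C Center) < k"
    using st by (auto simp: stable_def ready_def vtx_def deg_Center)
  have branch: "card (C (vtx i j)) < 2" if "i \<in> {1..k}" "j \<noteq> 0" for i j
  proof -
    have "vtx i j \<in> instar_verts k"
      using that unfolding instar_verts_def by blast
    then show ?thesis
      using st that by (auto simp: stable_def ready_def deg_vtx)
  qed
  from C show ?thesis
  proof cases
    case initial
    then show ?thesis
      using center by (simp add: Delta_def)
  next
    case (first n)
    then show ?thesis
      using center card_center_first_wave by simp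
  next
    case (second Y F)
    then have "card F < k"
      using center card_center_second_wave by simp
    then have "F \<noteq> {1..k}"
      by auto
    then obtain i where i: "i \<in> {1..k}" "i \<notin> F"
      using second(3) by blast
    then have "C (vtx i 1) = {Y (i, 1), Y (i, 2)}"
      by (simp add: second(1) second_wave_def vtx_def)
    moreover have "Y (i, 1) < Y (i, 2)"
      using second(2) i by (simp add: rect_SYT_2_iff)
    ultimately have "card (C (vtx i 1)) = 2"
      by simp
    then show ?thesis
      using branch[of i 1] i by simp
  next
    case (final Y)
    then show ?thesis
      by simp
  qed
qed

lemma stable_config_of:
  assumes "k \<ge> 1"
  shows "stable k (config_of k 2 Y)"
  unfolding stable_def
proof
  fix x assume "x \<in> instar_verts k"
  then obtain i j where x: "x = vtx i j" and i: "i \<in> {1..k}"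
    by (auto simp: instar_verts_def)
  show "\<not> ready k (config_of k 2 Y) x"
  proof (cases "j = 0")
    case True
    then show ?thesis
      using assms by (simp add: x ready_def vtx_def deg_Center config_of_def)
  next
    case False
    then have "card (config_of k 2 Y x) \<le> 1"
      by (simp add: x vtx_def config_of_def)
    then show ?thesis
      using deg_vtx[OF i False] by (simp add: x ready_def)
  qed
qed

lemma fires_center_fire:
  "\<lbrakk>ready k C Center; strict_mono_on {1..k} n; n ` {1..k} \<subseteq> C Center\<rbrakk> \<Longrightarrow>
    fires k C (center_fire k C n)"
  unfolding center_fire_def by (rule fires.center)

lemma fires_branch_fire:
  "\<lbrakk>i \<in> {1..k}; j \<noteq> 0; ready k C (vtx i j); a \<in> C (vtx i j); b \<in> C (vtx i j); a < b\<rbrakk> \<Longrightarrow>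
    fires k C (branch_fire C i j a b)"
  unfolding branch_fire_def by (rule fires.branch)

text \<open>
  The branches may fire in any order, so the set of fired branches can grow one element at a time.
\<close>

lemma reachable_second_wave:
  assumes Y: "Y \<in> rect_SYT k 2" and "F \<subseteq> {1..k}"
  shows "reachable k (second_wave k Y {}) (second_wave k Y F)"
proof -
  have "finite F"
    using assms(2) finite_subset by blast
  then show ?thesis
    using assms(2)
  proof (induction F rule: finite_induct)
    case empty
    show ?case
      by (simp add: reachable_def)
  next
    case (insert i F)
    then have i: "i \<in> {1..k}"
      by simp
    have less: "Y (i, 1) < Y (i, 2)"
      using Y i by (simp add: rect_SYT_2_iff)
    have chips: "second_wave k Y F (vtx i 1) = {Y (i, 1), Y (i, 2)}"
      using i insert.hyps by (simp add: second_wave_def vtx_def)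
    have "fires k (second_wave k Y F) (second_wave k Y (insert i F))"
      unfolding branch_fire_second_wave[OF i insert.hyps(2), symmetric]
      using less i deg_vtx[OF i, of 1] chips
      by (intro fires_branch_fire) (auto simp: ready_def)
    then show ?case
      using insert by (auto simp: reachable_def)
  qed
qed

text \<open>
  The two columns of \<open>Y\<close> serve as the chips of the first two firings of the center; since the
  rows of \<open>Y\<close> increase, sorting them gives \<open>Y\<close> back.
\<close>

lemma reachable_config_of:
  assumes Y: "Y \<in> rect_SYT k 2"
  shows "reachable k (Delta k 2) (config_of k 2 Y)"
proof -
  define n where "n = (\<lambda>i. Y (i, 1))"
  define n' where "n' = (\<lambda>i. Y (i, 2))"
  have n: "strict_mono_on {1..k} n" and n': "strict_mono_on {1..k} n'"
    and row: "\<And>i. i \<in> {1..k} \<Longrightarrow> n i < n' i"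
    and ext: "Y \<in> extensional ({1..k} \<times> {1..2})"
    and bij: "bij_betw Y ({1..k} \<times> {1..2}) {1..k * 2}"
    using Y by (auto simp: rect_SYT_2_iff n_def n'_def)
  have cols: "n ` {1..k} = Y ` ({1..k} \<times> {1})" "n' ` {1..k} = Y ` ({1..k} \<times> {2})"
    by (auto simp: n_def n'_def)
  have "n' ` {1..k} = Y ` ({1..k} \<times> {1..2} - {1..k} \<times> {1})"
    unfolding cols by (intro arg_cong[where f = "image Y"]) auto
  also have "\<dots> = Y ` ({1..k} \<times> {1..2}) - n ` {1..k}"
    using bij unfolding cols by (intro inj_on_image_set_diff[of Y "{1..k} \<times> {1..2}"])
      (auto simp: bij_betw_def)
  finally have rest: "n' ` {1..k} = {1..k * 2} - n ` {1..k}"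
    using bij by (simp add: bij_betw_def)
  have "Y ` ({1..k} \<times> {1}) \<subseteq> Y ` ({1..k} \<times> {1..2})"
    by (intro image_mono) auto
  then have sub: "n ` {1..k} \<subseteq> {1..k * 2}"
    using bij unfolding cols bij_betw_def by simp
  have rows: "sorted_rows k n n' = Y"
  proof
    fix c
    show "sorted_rows k n n' c = Y c"
    proof (cases "c \<in> {1..k} \<times> {1..2::nat}")
      case True
      then obtain i j where c: "c = (i, j)" and i: "i \<in> {1..k}" and j: "j = 1 \<or> j = 2"
        by fastforce
      have "Y (i, 1) < Y (i, 2)"
        using row[OF i] by (simp add: n_def n'_def)
      then show ?thesis
        using i j by (auto simp: c sorted_rows_def n_def n'_def)
    next
      case False
      then have "Y c = undefined"
        by (rule extensional_arb[OF ext])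
      moreover have "sorted_rows k n n' c = undefined"
        using False unfolding sorted_rows_def by (rule restrict_apply[THEN trans, OF if_not_P])
      ultimately show ?thesis
        by simp
    qed
  qed
  have 1: "fires k (Delta k 2) (first_wave k n)"
    unfolding center_fire_Delta[symmetric] using n sub
    by (intro fires_center_fire) (auto simp: ready_def deg_Center Delta_def)
  have "fires k (first_wave k n) (second_wave k (sorted_rows k n n') {})"
    unfolding center_fire_first_wave[OF rest, symmetric]
    using n' rest card_center_first_wave[OF n sub]
    by (intro fires_center_fire) (auto simp: ready_def deg_Center first_wave_def)
  then have 2: "fires k (first_wave k n) (second_wave k Y {})"
    by (simp only: rows)
  have 3: "reachable k (second_wave k Y {}) (second_wave k Y {1..k})"
    by (rule reachable_second_wave[OF Y]) simp
  have "fires k (second_wave k Y {1..k}) (center_fire k (second_wave k Y {1..k}) n)"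
    using n card_center_second_wave[OF Y, of "{1..k}"]
    by (intro fires_center_fire) (auto simp: ready_def deg_Center second_wave_def n_def)
  then have 4: "fires k (second_wave k Y {1..k}) (config_of k 2 Y)"
    by (subst (asm) center_fire_second_wave) (simp_all add: n_def)
  show ?thesis
    using 1 2 3 4 unfolding reachable_def
    by (meson converse_rtranclp_into_rtranclp rtranclp.rtrancl_into_rtrancl)
qed

lemma stable_configs_eq:
  assumes "k \<ge> 1"
  shows "stable_configs k 2 = config_of k 2 ` rect_SYT k 2"
proof
  show "stable_configs k 2 \<subseteq> config_of k 2 ` rect_SYT k 2"
    using stable_wave_stage[OF assms reachable_wave_stage[OF assms]]
    by (auto simp: stable_configs_def)
  show "config_of k 2 ` rect_SYT k 2 \<subseteq> stable_configs k 2"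
    using assms by (auto simp: stable_configs_def intro: stable_config_of reachable_config_of)
qed

lemma tableau_of_config_of:
  assumes "Y \<in> rect_SYT k m"
  shows "tableau_of k m (config_of k m Y) = Y"
proof (rule extensionalityI[of _ "{1..k} \<times> {1..m}"])
  show "tableau_of k m (config_of k m Y) \<in> extensional ({1..k} \<times> {1..m})"
    by (simp add: tableau_of_def)
  show "Y \<in> extensional ({1..k} \<times> {1..m})"
    using assms by (simp add: rect_SYT_def)
qed (auto simp: tableau_of_def config_of_def vtx_def)

section \<open>Counting two-column tableaux\<close>

definition two_column_cells :: "nat \<Rightarrow> nat \<Rightarrow> (nat \<times> nat) set" where
  "two_column_cells a b = {1..a} \<times> {1} \<union> {1..b} \<times> {2}"

text \<open>
  Standard Young tableaux with column lengths \<open>b \<le> a\<close>, that is, of the shape conjugate to \<open>(a, b)\<close>.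
  Unequal lengths are needed for a recursion that removes one cell at a time.
\<close>

definition two_column_SYT :: "nat \<Rightarrow> nat \<Rightarrow> (nat \<times> nat \<Rightarrow> nat) set" where
  "two_column_SYT a b = {Y \<in> extensional (two_column_cells a b).
     bij_betw Y (two_column_cells a b) {1..a + b} \<and>
     (\<forall>i\<in>{1..b}. Y (i, 1) < Y (i, 2)) \<and>
     strict_mono_on {1..a} (\<lambda>i. Y (i, 1)) \<and> strict_mono_on {1..b} (\<lambda>i. Y (i, 2))}"

lemma rect_SYT_2_eq_two_column_SYT: "rect_SYT k 2 = two_column_SYT k k"
proof -
  have "{1..k} \<times> {1..2} = two_column_cells k k"
    by (auto simp: two_column_cells_def)
  then show ?thesis
    by (auto simp: rect_SYT_2_iff two_column_SYT_def mult_2_right)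
qed

lemma card_fun_upd_image:
  assumes "T \<subseteq> extensional A" "c \<notin> A"
  shows "card ((\<lambda>Y. Y(c := v)) ` T) = card T"
proof (rule card_image, rule inj_onI)
  fix Y Z assume "Y \<in> T" "Z \<in> T" and eq: "Y(c := v) = Z(c := v)"
  then have "Y c = Z c"
    using assms by (metis extensional_arb subsetD)
  then show "Y = Z"
    using eq by (metis fun_upd_triv fun_upd_upd)
qed

lemma bij_betw_add_max:
  assumes "c \<notin> A"
  shows "bij_betw (Y(c := Suc n)) (insert c A) {1..Suc n} \<longleftrightarrow> bij_betw Y A {1..n}"
proof -
  have "bij_betw (Y(c := Suc n)) A {1..n} \<longleftrightarrow> bij_betw Y A {1..n}"
    using assms by (intro bij_betw_cong) auto
  moreover have "{1..Suc n} = {1..n} \<union> {Suc n}"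
    by auto
  ultimately show ?thesis
    using notIn_Un_bij_betw3[of c A "Y(c := Suc n)" "{1..n}"] assms by simp
qed

lemma strict_mono_on_Suc_iff:
  fixes h :: "nat \<Rightarrow> nat"
  shows "strict_mono_on {1..Suc a} h \<longleftrightarrow>
    strict_mono_on {1..a} h \<and> (\<forall>i\<in>{1..a}. h i < h (Suc a))"
  by (auto simp: strict_mono_on_def le_Suc_eq)

lemma two_column_cells_Suc:
  "two_column_cells (Suc a) b = insert (Suc a, 1) (two_column_cells a b)"
  "two_column_cells a (Suc b) = insert (Suc b, 2) (two_column_cells a b)"
  by (auto simp: two_column_cells_def)

lemma two_column_entry_less:
  assumes "bij_betw Y (two_column_cells a b) {1..n}"
  shows "i \<in> {1..a} \<Longrightarrow> Y (i, 1) < Suc n" "i \<in> {1..b} \<Longrightarrow> Y (i, 2) < Suc n"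
  using bij_betw_apply[OF assms, of "(i, 1)"] bij_betw_apply[OF assms, of "(i, 2)"]
  by (auto simp: two_column_cells_def)

lemma extensional_fun_upd_insert:
  assumes "Y \<in> extensional A"
  shows "Y(c := v) \<in> extensional (insert c A)"
  using assms by (auto simp: extensional_def)

text \<open>
  A new largest entry below the first column increases along that column whatever \<open>Y\<close> is, and
  lies in no row with a second entry because \<open>b \<le> a\<close>.
\<close>

lemma two_column_SYT_add_first:
  assumes "b \<le> a" and ext: "Y \<in> extensional (two_column_cells a b)"
  shows "Y((Suc a, 1) := Suc (a + b)) \<in> two_column_SYT (Suc a) b \<longleftrightarrow> Y \<in> two_column_SYT a b"
proof -
  let ?Z = "Y((Suc a, 1) := Suc (a + b))"
  have "(Suc a, 1) \<notin> two_column_cells a b"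
    by (simp add: two_column_cells_def)
  then have bij: "bij_betw ?Z (two_column_cells (Suc a) b) {1..Suc a + b} \<longleftrightarrow>
      bij_betw Y (two_column_cells a b) {1..a + b}"
    unfolding two_column_cells_Suc add_Suc by (rule bij_betw_add_max)
  have rows: "(\<forall>i\<in>{1..b}. ?Z (i, 1) < ?Z (i, 2)) \<longleftrightarrow> (\<forall>i\<in>{1..b}. Y (i, 1) < Y (i, 2))"
    using assms(1) by (intro ball_cong) auto
  have col1: "strict_mono_on {1..Suc a} (\<lambda>i. ?Z (i, 1)) \<longleftrightarrow> strict_mono_on {1..a} (\<lambda>i. Y (i, 1))"
    if "bij_betw Y (two_column_cells a b) {1..a + b}"
    using two_column_entry_less(1)[OF that] unfolding strict_mono_on_Suc_iff
    by (auto simp: strict_mono_on_def)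
  have col2: "(\<lambda>i. ?Z (i, 2)) = (\<lambda>i. Y (i, 2))"
    by auto
  have ext': "?Z \<in> extensional (two_column_cells (Suc a) b)"
    unfolding two_column_cells_Suc by (rule extensional_fun_upd_insert[OF ext])
  show ?thesis
    unfolding two_column_SYT_def mem_Collect_eq col2 using bij rows col1 ext ext' by blast
qed

text \<open>
  The row of the new cell already has its first entry because \<open>Suc b \<le> a\<close>, and any such entry is
  smaller than the new one.
\<close>

lemma two_column_SYT_add_second:
  assumes "Suc b \<le> a" and ext: "Y \<in> extensional (two_column_cells a b)"
  shows "Y((Suc b, 2) := Suc (a + b)) \<in> two_column_SYT a (Suc b) \<longleftrightarrow> Y \<in> two_column_SYT a b"
proof -
  let ?Z = "Y((Suc b, 2) := Suc (a + b))"
  have "(Suc b, 2) \<notin> two_column_cells a b"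
    by (simp add: two_column_cells_def)
  then have bij: "bij_betw ?Z (two_column_cells a (Suc b)) {1..a + Suc b} \<longleftrightarrow>
      bij_betw Y (two_column_cells a b) {1..a + b}"
    unfolding two_column_cells_Suc add_Suc_right by (rule bij_betw_add_max)
  have rows: "(\<forall>i\<in>{1..Suc b}. ?Z (i, 1) < ?Z (i, 2)) \<longleftrightarrow> (\<forall>i\<in>{1..b}. Y (i, 1) < Y (i, 2))"
    if "bij_betw Y (two_column_cells a b) {1..a + b}"
    using two_column_entry_less(1)[OF that, of "Suc b"] assms(1)
    by (auto simp: le_Suc_eq)
  have col2: "strict_mono_on {1..Suc b} (\<lambda>i. ?Z (i, 2)) \<longleftrightarrow> strict_mono_on {1..b} (\<lambda>i. Y (i, 2))"
    if "bij_betw Y (two_column_cells a b) {1..a + b}"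
    using two_column_entry_less(2)[OF that] unfolding strict_mono_on_Suc_iff
    by (auto simp: strict_mono_on_def)
  have col1: "(\<lambda>i. ?Z (i, 1)) = (\<lambda>i. Y (i, 1))"
    by auto
  have ext': "?Z \<in> extensional (two_column_cells a (Suc b))"
    unfolding two_column_cells_Suc by (rule extensional_fun_upd_insert[OF ext])
  show ?thesis
    unfolding two_column_SYT_def mem_Collect_eq col1 using bij rows col2 ext ext' by blast
qed

text \<open>
  Giving the cell \<open>c\<close> the value \<open>v\<close> is undone by resetting it to \<open>undefined\<close>, the value that
  extensional functions take off their domain, so the two sets correspond bijectively.
\<close>

lemma card_max_at_end:
  assumes ext: "T \<subseteq> extensional A" "T' \<subseteq> extensional (insert c A)" and c: "c \<notin> A"
    and add: "\<And>Y. Y \<in> extensional A \<Longrightarrow> Y(c := v) \<in> T' \<longleftrightarrow> Y \<in> T"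
  shows "card {Y \<in> T'. Y c = v} = card T"
proof -
  have "{Y \<in> T'. Y c = v} = (\<lambda>Y. Y(c := v)) ` T"
  proof
    show "(\<lambda>Y. Y(c := v)) ` T \<subseteq> {Y \<in> T'. Y c = v}"
      using ext add by auto
    show "{Y \<in> T'. Y c = v} \<subseteq> (\<lambda>Y. Y(c := v)) ` T"
    proof
      fix Y assume "Y \<in> {Y \<in> T'. Y c = v}"
      then have Y: "Y \<in> T'" "(Y(c := undefined))(c := v) = Y"
        by auto
      have "Y(c := undefined) \<in> extensional A"
        using Y(1) ext(2) by (auto simp: extensional_def)
      then have "Y(c := undefined) \<in> T"
        using add Y by metis
      then show "Y \<in> (\<lambda>Y. Y(c := v)) ` T"
        using Y(2) by (metis imageI)
    qed
  qed
  then show ?thesis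
    using card_fun_upd_image[OF ext(1) c] by simp
qed

lemma two_column_SYT_extensional: "two_column_SYT a b \<subseteq> extensional (two_column_cells a b)"
  by (auto simp: two_column_SYT_def)

lemma card_max_in_first_column:
  assumes "b \<le> a"
  shows "card {Y \<in> two_column_SYT (Suc a) b. Y (Suc a, 1) = Suc (a + b)} =
    card (two_column_SYT a b)"
  by (rule card_max_at_end[OF two_column_SYT_extensional
        two_column_SYT_extensional[of "Suc a" "b", unfolded two_column_cells_Suc]
        _ two_column_SYT_add_first[OF assms]]) (simp_all add: two_column_cells_def)

lemma card_max_in_second_column:
  assumes "Suc b \<le> a"
  shows "card {Y \<in> two_column_SYT a (Suc b). Y (Suc b, 2) = Suc (a + b)} =
    card (two_column_SYT a b)"
  by (rule card_max_at_end[OF two_column_SYT_extensional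
        two_column_SYT_extensional[of "a" "Suc b", unfolded two_column_cells_Suc]
        _ two_column_SYT_add_second[OF assms]]) (simp_all add: two_column_cells_def)

text \<open>
  Nothing may follow the largest entry in its column or row. Hence it ends its column, and it
  ends the first column only if that one is longer.
\<close>

lemma two_column_SYT_max_cases:
  assumes Y: "Y \<in> two_column_SYT a b" and "b \<le> a" "0 < a"
  obtains "b < a" "Y (a, 1) = a + b" | "0 < b" "Y (b, 2) = a + b"
proof -
  have bij: "bij_betw Y (two_column_cells a b) {1..a + b}"
    and row: "\<And>i. i \<in> {1..b} \<Longrightarrow> Y (i, 1) < Y (i, 2)"
    and col1: "strict_mono_on {1..a} (\<lambda>i. Y (i, 1))"
    and col2: "strict_mono_on {1..b} (\<lambda>i. Y (i, 2))"
    using Y by (auto simp: two_column_SYT_def)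
  have "a + b \<in> Y ` two_column_cells a b"
    using bij assms(3) by (auto simp: bij_betw_def)
  then consider i where "i \<in> {1..a}" "Y (i, 1) = a + b" | i where "i \<in> {1..b}" "Y (i, 2) = a + b"
    by (auto simp: two_column_cells_def)
  then show thesis
  proof cases
    case (1 i)
    have "\<not> i < a"
      using strict_mono_onD[OF col1, of i a] two_column_entry_less(1)[OF bij, of a] 1 by auto
    then have i: "i = a"
      using 1 by simp
    have "a \<noteq> b"
      using row[of a] two_column_entry_less(2)[OF bij, of a] 1 i by auto
    then show thesis
      using that(1) 1 i assms(2) by simp
  next
    case (2 i)
    have "\<not> i < b"
      using strict_mono_onD[OF col2, of i b] two_column_entry_less(2)[OF bij, of b] 2 by auto
    then have "i = b"
      using 2 by simp
    then show thesis
      using that(2) 2 by simp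
  qed
qed

lemma finite_two_column_SYT: "finite (two_column_SYT a b)"
proof (rule finite_subset)
  show "two_column_SYT a b \<subseteq> two_column_cells a b \<rightarrow>\<^sub>E {1..a + b}"
    by (auto simp: two_column_SYT_def PiE_def bij_betw_def)
  show "finite (two_column_cells a b \<rightarrow>\<^sub>E {1..a + b})"
    by (intro finite_PiE) (auto simp: two_column_cells_def)
qed

text \<open>
  The value is the ballot number \<open>(a + b choose a) - (a + b choose Suc a)\<close>, written without
  subtraction. For \<open>0 < b < a\<close> the recursion is Pascal's rule for both binomial coefficients.
  For \<open>b = a\<close> the largest entry must be in the second column; the missing summand would be
  \<open>(n choose (a - 1)) - (n choose a)\<close> with \<open>n = 2 * a - 1\<close>, which vanishes by symmetry.
\<close>

lemma card_two_column_SYT: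
  "b \<le> a \<Longrightarrow> card (two_column_SYT a b) + ((a + b) choose Suc a) = (a + b) choose a"
proof (induction "a + b" arbitrary: a b)
  case 0
  have "two_column_SYT 0 0 = {\<lambda>_. undefined}"
    by (auto simp: two_column_SYT_def two_column_cells_def bij_betw_def)
  then show ?case
    using 0 by simp
next
  case (Suc n)
  define first where "first = {Y \<in> two_column_SYT a b. Y (a, 1) = a + b}"
  define second where "second = {Y \<in> two_column_SYT a b. Y (b, 2) = a + b}"
  obtain a' where a: "a = Suc a'"
    using Suc.hyps(2) Suc.prems by (cases a) auto
  then have n: "n = a' + b"
    using Suc.hyps(2) by simp
  have fin: "finite first" "finite second"
    by (simp_all add: first_def second_def finite_two_column_SYT)
  have first_card: "card first + (n choose a) = n choose a'" if "b < a"
    using card_max_in_first_column[of b a'] Suc.hyps(1)[of a' b] that n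
    by (simp add: first_def a)
  show ?case
  proof (cases b)
    case 0
    have "two_column_SYT a b = first"
      using two_column_SYT_max_cases[OF _ Suc.prems] a 0 by (auto simp: first_def)
    then show ?thesis
      using first_card a 0 n by (simp add: binomial_eq_0)
  next
    case (Suc b')
    have second_card: "card second + (n choose Suc a) = n choose a"
      using card_max_in_second_column[of b' a] Suc.hyps(1)[of a b'] Suc.prems Suc n a
      by (simp add: second_def)
    show ?thesis
    proof (cases "b < a")
      case True
      have "two_column_SYT a b = first \<union> second"
        using two_column_SYT_max_cases[OF _ Suc.prems] a by (auto simp: first_def second_def)
      moreover have "first \<inter> second = {}"
      proof -
        have "Y (a, 1) \<noteq> Y (b, 2)" if "Y \<in> two_column_SYT a b" for Y
        proof
          assume "Y (a, 1) = Y (b, 2)"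
          moreover have "inj_on Y (two_column_cells a b)"
            using that by (auto simp: two_column_SYT_def bij_betw_def)
          ultimately have "(a, 1::nat) = (b, 2)"
            using a Suc by (intro inj_onD[of Y]) (auto simp: two_column_cells_def)
          then show False
            by simp
        qed
        then show ?thesis
          unfolding disjoint_iff first_def second_def by (metis (mono_tags, lifting) mem_Collect_eq)
      qed
      ultimately have "card (two_column_SYT a b) = card first + card second"
        using fin by (simp add: card_Un_disjoint)
      then show ?thesis
        using first_card[OF True] second_card a n by simp
    next
      case False
      then have ab: "b = a"
        using Suc.prems by simp
      have "two_column_SYT a b = second"
        using two_column_SYT_max_cases[OF _ Suc.prems] a False by (auto simp: second_def)
      moreover have "n choose a' = n choose a"
        using binomial_symmetric[of a' n] n ab a by simp
      ultimately show ?thesis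
        using second_card a n by simp
    qed
  qed
qed

lemma card_rect_SYT_2: "real (card (rect_SYT k 2)) = 1 / (real k + 1) * real ((2 * k) choose k)"
proof -
  have "card (rect_SYT k 2) + ((2 * k) choose Suc k) = (2 * k) choose k"
    using card_two_column_SYT[of k k] by (simp add: rect_SYT_2_eq_two_column_SYT mult_2)
  then have diff: "real (card (rect_SYT k 2)) = real ((2 * k) choose k) - real ((2 * k) choose Suc k)"
    by linarith
  have "Suc k * ((2 * k) choose Suc k) = k * ((2 * k) choose k)"
    using binomial_absorption[of k "2 * k"] binomial_absorb_comp[of "2 * k" k]
    by (metis add_diff_cancel_left' mult_2)
  then have absorb: "(real k + 1) * real ((2 * k) choose Suc k) = real k * real ((2 * k) choose k)"
    by (metis of_nat_Suc of_nat_mult add.commute)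
  have "(real k + 1) * real (card (rect_SYT k 2)) = real ((2 * k) choose k)"
    unfolding diff right_diff_distrib absorb by (simp add: distrib_right)
  then show ?thesis
    by (simp add: field_simps)
qed

section \<open>The bijection\<close>

theorem theorem5p1:
  fixes k :: nat
  assumes "k \<ge> 1"
  shows "bij_betw (tableau_of k 2) (stable_configs k 2) (rect_SYT k 2) \<and>
    (\<forall>C\<in>stable_configs k 2. \<forall>i\<in>{1..k}. \<forall>j\<in>{1..2}.
           C (vtx i j) = {tableau_of k 2 C (i, j)}) \<and>
    bij_betw (config_of k 2) (rect_SYT k 2) (stable_configs k 2) \<and>
    (\<forall>C\<in>stable_configs k 2. config_of k 2 (tableau_of k 2 C) = C) \<and>
    (\<forall>Y\<in>rect_SYT k 2. tableau_of k 2 (config_of k 2 Y) = Y) \<and>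
    real (card (rect_SYT k 2)) = 1 / (real k + 1) * real ((2 * k) choose k) \<and>
    real (card (stable_configs k 2)) = 1 / (real k + 1) * real ((2 * k) choose k)"
proof -
  have inverse: "tableau_of k 2 (config_of k 2 Y) = Y" if "Y \<in> rect_SYT k 2" for Y
    using that by (rule tableau_of_config_of)
  note stable = stable_configs_eq[OF assms]
  have inverse': "config_of k 2 (tableau_of k 2 C) = C" if "C \<in> stable_configs k 2" for C
    using that inverse unfolding stable by force
  have config: "bij_betw (config_of k 2) (rect_SYT k 2) (stable_configs k 2)"
    unfolding stable by (rule inj_on_imp_bij_betw) (metis inj_onI inverse)
  moreover have "bij_betw (tableau_of k 2) (stable_configs k 2) (rect_SYT k 2)"
    using inverse inverse' unfolding stable
    by (intro bij_betw_byWitness[where f' = "config_of k 2"]) auto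
  moreover have "C (vtx i j) = {tableau_of k 2 C (i, j)}"
    if "C \<in> stable_configs k 2" "i \<in> {1..k}" "j \<in> {1..2}" for C i j
  proof -
    have "config_of k 2 (tableau_of k 2 C) (vtx i j) = {tableau_of k 2 C (i, j)}"
      using that by (simp add: config_of_def vtx_def)
    then show ?thesis
      by (simp add: inverse'[OF that(1)])
  qed
  moreover have "card (stable_configs k 2) = card (rect_SYT k 2)"
    using bij_betw_same_card[OF config] by simp
  ultimately show ?thesis
    using inverse inverse' card_rect_SYT_2[of k] by simp
qed

end
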